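(* Let $P_1,P_2$ be finite posets, let $\mathcal{G}_1$ be a decomposition set of $P_1$ and $\mathcal{G}_2$ a decomposition set of $P_2$. Then there is an isomorphism of posets $$\mathcal{D}(P_1\times P_2,\ \mathcal{G}_1\times\mathcal{G}_2)\ \cong\ \mathcal{D}(P_1,\mathcal{G}_1)\times\mathcal{D}(P_2,\mathcal{G}_2),$$ given by the mutually inverse maps $A\mapsto(\pi_1(A),\pi_2(A))$ and $(A_1,A_2)\mapsto A_1\times A_2$, where $\pi_1,\pi_2$ are the coordinate projections of $P_1\times P_2$.
   Context: Let $P$ be a finite poset. A decomposition in $P$ is a triple $(x,z,y)$ of elements of $P$ with $x\le z\le y$ such that there is an order isomorphism $\psi:[x,z]\times[z,y]\to[x,y]$ with $\psi(u,z)=u$ for all $u\in[x,z]$ and $\psi(z,v)=v$ for all $v\in[z,y]$. It is trivial if $z=x$ or $z=y$. A decomposition set of $P$ is a set $\mathcal{G}$ of decompositions in $P$ containing all trivial decompositions. For $A\subseteq P$, $\langle A\rangle_{\mathcal{G}}$ is the smallest (intersection of all) $B$ with $A\subseteq B\subseteq P$ such that for all $(x,z,y)\in\mathcal{G}$: $x,y\in B$ implies $z\in B$. The decomposition complex is $\mathcal{D}(P,\mathcal{G})=\{\langle C\rangle_{\mathcal{G}}\mid C\text{ a non-empty chain in }P\}$, ordered by inclusion. Products of posets carry the componentwise order. The product decomposition set on $P_1\times P_2$ is $\mathcal{G}_1\times\mathcal{G}_2=\{((x_1,x_2),(z_1,z_2),(y_1,y_2))\mid (x_1,z_1,y_1)\in\mathcal{G}_1,\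 (x_2,z_2,y_2)\in\mathcal{G}_2\}$. *)

theory Defs
  imports Main "HOL-Library.Product_Order"
begin

text \<open>
  A finite poset is a finite subset \<open>P\<close> of a type of class \<open>order\<close>, with the induced order; this
  includes the empty poset. Pairs carry the componentwise order of \<open>Product_Order\<close>, so
  \<open>P1 \<times> P2\<close> is the product poset, and sets are ordered by inclusion.
\<close>

definition order_iso_on :: "('a::order \<Rightarrow> 'b::order) \<Rightarrow> 'a set \<Rightarrow> 'b set \<Rightarrow> bool" where
  "order_iso_on f A B \<longleftrightarrow>
     bij_betw f A B \<and> (\<forall>x\<in>A. \<forall>y\<in>A. x \<le> y \<longleftrightarrow> f x \<le> f y)"

definition interval_in :: "'a::order set \<Rightarrow> 'a \<Rightarrow> 'a \<Rightarrow> 'a set" where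
  "interval_in P x y = {u \<in> P. x \<le> u \<and> u \<le> y}"

definition decompositions :: "'a::order set \<Rightarrow> ('a \<times> 'a \<times> 'a) set" where
  "decompositions P =
     {(x, z, y). x \<in> P \<and> z \<in> P \<and> y \<in> P \<and> x \<le> z \<and> z \<le> y \<and>
        (\<exists>\<psi>. order_iso_on \<psi> (interval_in P x z \<times> interval_in P z y) (interval_in P x y) \<and>
             (\<forall>u \<in> interval_in P x z. \<psi> (u, z) = u) \<and>
             (\<forall>v \<in> interval_in P z y. \<psi> (z, v) = v))}"

definition trivial_decompositions :: "'a::order set \<Rightarrow> ('a \<times> 'a \<times> 'a) set" where
  "trivial_decompositions P = {(x, z, y) \<in> decompositions P. z = x \<or> z = y}"

definition decomposition_set :: "'a::order set \<Rightarrow> ('a \<times> 'a \<times> 'a) set \<Rightarrow> bool" where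
  "decomposition_set P G \<longleftrightarrow> trivial_decompositions P \<subseteq> G \<and> G \<subseteq> decompositions P"

text \<open>
  For \<open>A \<subseteq> P\<close> and \<open>G \<subseteq> decompositions P\<close> the intersected family contains \<open>P\<close>, so it is non-empty.
\<close>

definition decomposition_closure ::
    "'a::order set \<Rightarrow> ('a \<times> 'a \<times> 'a) set \<Rightarrow> 'a set \<Rightarrow> 'a set" where
  "decomposition_closure P G A =
     \<Inter> {B. A \<subseteq> B \<and> B \<subseteq> P \<and> (\<forall>(x, z, y) \<in> G. x \<in> B \<and> y \<in> B \<longrightarrow> z \<in> B)}"

definition decomposition_complex ::
    "'a::order set \<Rightarrow> ('a \<times> 'a \<times> 'a) set \<Rightarrow> 'a set set" where
  "decomposition_complex P G =
     {decomposition_closure P G C | C.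
        C \<subseteq> P \<and> C \<noteq> {} \<and> Complete_Partial_Order.chain (\<le>) C}"

definition prod_decomposition_set ::
    "('a \<times> 'a \<times> 'a) set \<Rightarrow> ('b \<times> 'b \<times> 'b) set \<Rightarrow>
     (('a \<times> 'b) \<times> ('a \<times> 'b) \<times> ('a \<times> 'b)) set" where
  "prod_decomposition_set G1 G2 =
     {((x1, x2), (z1, z2), (y1, y2)) | x1 x2 z1 z2 y1 y2.
        (x1, z1, y1) \<in> G1 \<and> (x2, z2, y2) \<in> G2}"

end

theory Submission
  imports Defs
begin

text \<open>
  Everything rests on one identity: for a chain \<open>C\<close> in \<open>P1 \<times> P2\<close>, the closure of \<open>C\<close> is the product
  of the closures of its two projections (\<open>closure_chain_eq_Times\<close>).

  That the closure lies in this product is clear, since a product of closed sets is closed. For the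
  converse, trivial decompositions do the work. If \<open>(x1, x2) \<le> (y1, y2)\<close> are in \<open>C\<close>, then pairing
  \<open>(x1, x1, y1)\<close> with \<open>(x2, y2, y2)\<close> gives a decomposition of the product that forces \<open>(x1, y2)\<close> into
  the closure, and likewise \<open>(y1, x2)\<close>. Because \<open>C\<close> is a chain, this fills up the whole grid
  \<open>fst ` C \<times> snd ` C\<close>. Pairing a decomposition in one factor with a constant triple \<open>(b, b, b)\<close> in the
  other shows that horizontal and vertical slices of a closed set are closed, so the grid grows to
  the product of the closures, one coordinate at a time.

  The identity says that projecting maps the complex of the product into the product of the
  complexes and that \<open>A = fst ` A \<times> snd ` A\<close> there. It remains to see that every pair of non-empty
  chains is the pair of projections of a single chain. The L-shaped path that runs along the first
  chain at the bottom of the second, and then up the second chain at the top of the first, is such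
  a chain; this is the only place where finiteness enters.
\<close>

section \<open>Trivial decompositions\<close>

text \<open>The isomorphism \<open>{x} \<times> [x, y] \<rightarrow> [x, y]\<close> is the second projection, and dually at the top end.\<close>

lemma decomposition_set_bot_mem:
  assumes "decomposition_set P G" "x \<in> P" "y \<in> P" "x \<le> y"
  shows "(x, x, y) \<in> G"
proof -
  have "interval_in P x x = {x}"
    using assms(2) by (auto simp: interval_in_def)
  then have "order_iso_on snd (interval_in P x x \<times> interval_in P x y) (interval_in P x y)"
    by (auto simp: order_iso_on_def bij_betw_def inj_on_def less_eq_prod_def)
  moreover have "\<forall>u \<in> interval_in P x x. snd (u, x) = u"
    by (auto simp: interval_in_def)
  ultimately have "(x, x, y) \<in> decompositions P"
    unfolding decompositions_def using assms by (auto intro!: exI[of _ snd])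
  then show ?thesis
    using assms(1) by (auto simp: decomposition_set_def trivial_decompositions_def)
qed

lemma decomposition_set_top_mem:
  assumes "decomposition_set P G" "x \<in> P" "y \<in> P" "x \<le> y"
  shows "(x, y, y) \<in> G"
proof -
  have "interval_in P y y = {y}"
    using assms(3) by (auto simp: interval_in_def)
  then have "order_iso_on fst (interval_in P x y \<times> interval_in P y y) (interval_in P x y)"
    by (auto simp: order_iso_on_def bij_betw_def inj_on_def less_eq_prod_def)
  moreover have "\<forall>v \<in> interval_in P y y. fst (y, v) = v"
    by (auto simp: interval_in_def)
  ultimately have "(x, y, y) \<in> decompositions P"
    unfolding decompositions_def using assms by (auto intro!: exI[of _ fst])
  then show ?thesis
    using assms(1) by (auto simp: decomposition_set_def trivial_decompositions_def)
qed

section \<open>The closure operator\<close>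

lemma closure_superset: "A \<subseteq> decomposition_closure P G A"
  by (auto simp: decomposition_closure_def)

lemma closure_closed:
  assumes "(x, z, y) \<in> G" "x \<in> decomposition_closure P G A" "y \<in> decomposition_closure P G A"
  shows "z \<in> decomposition_closure P G A"
  unfolding decomposition_closure_def
proof (rule InterI)
  fix B
  assume B: "B \<in> {B. A \<subseteq> B \<and> B \<subseteq> P \<and> (\<forall>(x, z, y) \<in> G. x \<in> B \<and> y \<in> B \<longrightarrow> z \<in> B)}"
  have "x \<in> B" "y \<in> B"
    using assms(2,3) InterD[OF _ B] unfolding decomposition_closure_def by simp_all
  then show "z \<in> B"
    using B assms(1) by auto
qed

lemma closure_least:
  assumes "A \<subseteq> B" "B \<subseteq> P" "\<And>x z y. (x, z, y) \<in> G \<Longrightarrow> x \<in> B \<Longrightarrow> y \<in> B \<Longrightarrow> z \<in> B"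
  shows "decomposition_closure P G A \<subseteq> B"
  unfolding decomposition_closure_def using assms by (intro Inter_lower) auto

lemma closure_subset_carrier:
  assumes "decomposition_set P G" "A \<subseteq> P"
  shows "decomposition_closure P G A \<subseteq> P"
  using assms
  by (intro closure_least) (auto simp: decomposition_set_def decompositions_def)

section \<open>Closures of chains in a product\<close>

lemma closure_Times_subset:
  assumes G1: "decomposition_set P1 G1" and G2: "decomposition_set P2 G2"
    and C: "C \<subseteq> P1 \<times> P2"
  shows "decomposition_closure (P1 \<times> P2) (prod_decomposition_set G1 G2) C
    \<subseteq> decomposition_closure P1 G1 (fst ` C) \<times> decomposition_closure P2 G2 (snd ` C)"
    (is "_ \<subseteq> ?A1 \<times> ?A2")
proof (rule closure_least)
  have "fst ` C \<subseteq> ?A1" "snd ` C \<subseteq> ?A2"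
    by (rule closure_superset)+
  then show "C \<subseteq> ?A1 \<times> ?A2"
    by force
  have "fst ` C \<subseteq> P1" "snd ` C \<subseteq> P2"
    using C by auto
  then show "?A1 \<times> ?A2 \<subseteq> P1 \<times> P2"
    using closure_subset_carrier[OF G1] closure_subset_carrier[OF G2] by (intro Sigma_mono) auto
next
  fix x z y
  assume "(x, z, y) \<in> prod_decomposition_set G1 G2" "x \<in> ?A1 \<times> ?A2" "y \<in> ?A1 \<times> ?A2"
  then show "z \<in> ?A1 \<times> ?A2"
    by (auto simp: prod_decomposition_set_def intro: closure_closed)
qed

text \<open>
  A set that is closed under the product decompositions and contains a grid \<open>A1 \<times> A2\<close> contains the
  product of the closures: its slices are closed, because \<open>(b, b, b)\<close> is a trivial decomposition.
  The first coordinate is completed while the second stays in \<open>A2\<close>, and then the second coordinate.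
\<close>

lemma closure_Times_closure_subset:
  assumes G1: "decomposition_set P1 G1" and G2: "decomposition_set P2 G2"
    and A1: "A1 \<subseteq> P1" and A2: "A2 \<subseteq> P2"
    and grid: "A1 \<times> A2 \<subseteq> B" and B: "B \<subseteq> P1 \<times> P2"
    and closed: "\<And>x z y. (x, z, y) \<in> prod_decomposition_set G1 G2 \<Longrightarrow> x \<in> B \<Longrightarrow> y \<in> B \<Longrightarrow> z \<in> B"
  shows "decomposition_closure P1 G1 A1 \<times> decomposition_closure P2 G2 A2 \<subseteq> B"
proof -
  have row: "(a, b) \<in> B" if a: "a \<in> decomposition_closure P1 G1 A1" and b: "b \<in> A2" for a b
  proof -
    have bbb: "(b, b, b) \<in> G2"
      using decomposition_set_bot_mem[OF G2, of b b] b A2 by auto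
    have "decomposition_closure P1 G1 A1 \<subseteq> {a. (a, b) \<in> B}"
    proof (rule closure_least)
      fix x z y
      assume "(x, z, y) \<in> G1" "x \<in> {a. (a, b) \<in> B}" "y \<in> {a. (a, b) \<in> B}"
      then show "z \<in> {a. (a, b) \<in> B}"
        using closed[of "(x, b)" "(z, b)" "(y, b)"] bbb by (simp add: prod_decomposition_set_def)
    qed (use grid B b in auto)
    with a show ?thesis
      by auto
  qed
  have "(a, b) \<in> B"
    if a: "a \<in> decomposition_closure P1 G1 A1" and b: "b \<in> decomposition_closure P2 G2 A2" for a b
  proof -
    have "a \<in> P1"
      using closure_subset_carrier[OF G1 A1] a by auto
    then have aaa: "(a, a, a) \<in> G1"
      using decomposition_set_bot_mem[OF G1, of a a] by auto
    have "decomposition_closure P2 G2 A2 \<subseteq> {b. (a, b) \<in> B}"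
    proof (rule closure_least)
      fix x z y
      assume "(x, z, y) \<in> G2" "x \<in> {b. (a, b) \<in> B}" "y \<in> {b. (a, b) \<in> B}"
      then show "z \<in> {b. (a, b) \<in> B}"
        using closed[of "(a, x)" "(a, z)" "(a, y)"] aaa by (simp add: prod_decomposition_set_def)
    qed (use row a B in auto)
    with b show ?thesis
      by auto
  qed
  then show ?thesis
    by auto
qed

text \<open>
  For comparable points of \<open>C\<close>, the two remaining corners of the rectangle that they span are the
  middle elements of products of trivial decompositions. In a chain all points are comparable.
\<close>

lemma chain_grid_subset_closure:
  assumes G1: "decomposition_set P1 G1" and G2: "decomposition_set P2 G2"
    and C: "C \<subseteq> P1 \<times> P2" and chain: "Complete_Partial_Order.chain (\<le>) C"
  shows "fst ` C \<times> snd ` C \<subseteq> decomposition_closure (P1 \<times> P2) (prod_decomposition_set G1 G2) C"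
    (is "_ \<subseteq> ?A")
proof -
  have corners: "(x1, y2) \<in> ?A \<and> (y1, x2) \<in> ?A"
    if x: "(x1, x2) \<in> C" and y: "(y1, y2) \<in> C" and le: "(x1, x2) \<le> (y1, y2)" for x1 x2 y1 y2
  proof -
    have P: "x1 \<in> P1" "y1 \<in> P1" "x1 \<le> y1" "x2 \<in> P2" "y2 \<in> P2" "x2 \<le> y2"
      using x y le C by auto
    have "((x1, x2), (x1, y2), (y1, y2)) \<in> prod_decomposition_set G1 G2"
      "((x1, x2), (y1, x2), (y1, y2)) \<in> prod_decomposition_set G1 G2"
      using P decomposition_set_bot_mem[OF G1] decomposition_set_top_mem[OF G1]
        decomposition_set_bot_mem[OF G2] decomposition_set_top_mem[OF G2]
      by (simp_all add: prod_decomposition_set_def)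
    moreover have "(x1, x2) \<in> ?A" "(y1, y2) \<in> ?A"
      using x y closure_superset by auto
    ultimately show ?thesis
      using closure_closed by metis
  qed
  have "(x1, y2) \<in> ?A" if "(x1, x2) \<in> C" "(y1, y2) \<in> C" for x1 x2 y1 y2
    using chainD[OF chain that] corners that by blast
  then show ?thesis
    by auto
qed

lemma closure_chain_eq_Times:
  assumes G1: "decomposition_set P1 G1" and G2: "decomposition_set P2 G2"
    and C: "C \<subseteq> P1 \<times> P2" and chain: "Complete_Partial_Order.chain (\<le>) C"
  shows "decomposition_closure (P1 \<times> P2) (prod_decomposition_set G1 G2) C
    = decomposition_closure P1 G1 (fst ` C) \<times> decomposition_closure P2 G2 (snd ` C)"
    (is "?A = ?A1 \<times> ?A2")
proof
  show sub: "?A \<subseteq> ?A1 \<times> ?A2"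
    by (rule closure_Times_subset[OF G1 G2 C])
  have C12: "fst ` C \<subseteq> P1" "snd ` C \<subseteq> P2"
    using C by auto
  have "?A \<subseteq> P1 \<times> P2"
    using sub closure_subset_carrier[OF G1 C12(1)] closure_subset_carrier[OF G2 C12(2)] by blast
  then show "?A1 \<times> ?A2 \<subseteq> ?A"
    using closure_Times_closure_subset[OF G1 G2 C12 chain_grid_subset_closure[OF G1 G2 C chain]]
      closure_closed by metis
qed

section \<open>Chains with prescribed projections\<close>

text \<open>
  The witness is the L-shaped path through \<open>(min C1, min C2)\<close>, \<open>(max C1, min C2)\<close> and
  \<open>(max C1, max C2)\<close>.
\<close>

lemma chain_with_projections:
  fixes C1 :: "'a::order set" and C2 :: "'b::order set"
  assumes "finite C1" "C1 \<noteq> {}" and chain1: "Complete_Partial_Order.chain (\<le>) C1"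
    and "finite C2" "C2 \<noteq> {}" and chain2: "Complete_Partial_Order.chain (\<le>) C2"
  obtains C where "Complete_Partial_Order.chain (\<le>) C" "fst ` C = C1" "snd ` C = C2"
proof -
  obtain t where t: "t \<in> C1" "\<And>x. x \<in> C1 \<Longrightarrow> t \<le> x \<Longrightarrow> t = x"
    using finite_has_maximal[OF assms(1,2)] by auto
  obtain b where b: "b \<in> C2" "\<And>x. x \<in> C2 \<Longrightarrow> x \<le> b \<Longrightarrow> b = x"
    using finite_has_minimal[OF assms(4,5)] by auto
  have top: "x \<le> t" if "x \<in> C1" for x
    using chainD[OF chain1 that t(1)] t(2)[OF that] by auto
  have bot: "b \<le> x" if "x \<in> C2" for x
    using chainD[OF chain2 that b(1)] b(2)[OF that] by auto
  let ?C = "C1 \<times> {b} \<union> {t} \<times> C2"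
  show thesis
  proof
    show "Complete_Partial_Order.chain (\<le>) ?C"
      using top bot chainD[OF chain1] chainD[OF chain2] by (intro chainI) (auto; blast)
    show "fst ` ?C = C1" "snd ` ?C = C2"
      using t(1) b(1) by force+
  qed
qed

lemma chain_fst_image:
  assumes "Complete_Partial_Order.chain (\<le>) C"
  shows "Complete_Partial_Order.chain (\<le>) (fst ` C)"
  by (rule chain_imageI[OF assms]) (rule fst_mono)

lemma chain_snd_image:
  assumes "Complete_Partial_Order.chain (\<le>) C"
  shows "Complete_Partial_Order.chain (\<le>) (snd ` C)"
  by (rule chain_imageI[OF assms]) (rule snd_mono)

section \<open>The isomorphism of decomposition complexes\<close>

lemma decomposition_complexI:
  assumes "C \<subseteq> P" "C \<noteq> {}" "Complete_Partial_Order.chain (\<le>) C"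
  shows "decomposition_closure P G C \<in> decomposition_complex P G"
  using assms by (auto simp: decomposition_complex_def)

lemma decomposition_complex_nonempty:
  assumes "A \<in> decomposition_complex P G"
  shows "A \<noteq> {}"
proof -
  obtain C where "A = decomposition_closure P G C" "C \<noteq> {}"
    using assms by (auto simp: decomposition_complex_def)
  then show ?thesis
    using closure_superset[of C P G] by auto
qed

lemma decomposition_complex_prod:
  assumes fin: "finite P1" "finite P2"
    and G1: "decomposition_set P1 G1" and G2: "decomposition_set P2 G2"
  shows "decomposition_complex (P1 \<times> P2) (prod_decomposition_set G1 G2)
    = (\<lambda>(A1, A2). A1 \<times> A2) ` (decomposition_complex P1 G1 \<times> decomposition_complex P2 G2)"
    (is "?D = ?times ` (?D1 \<times> ?D2)")
proof (intro equalityI subsetI)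
  fix A
  assume "A \<in> ?D"
  then obtain C where A: "A = decomposition_closure (P1 \<times> P2) (prod_decomposition_set G1 G2) C"
    and C: "C \<subseteq> P1 \<times> P2" "C \<noteq> {}" "Complete_Partial_Order.chain (\<le>) C"
    by (auto simp: decomposition_complex_def)
  have "decomposition_closure P1 G1 (fst ` C) \<in> ?D1" "decomposition_closure P2 G2 (snd ` C) \<in> ?D2"
    using C by (auto intro!: decomposition_complexI chain_fst_image chain_snd_image)
  then show "A \<in> ?times ` (?D1 \<times> ?D2)"
    unfolding A closure_chain_eq_Times[OF G1 G2 C(1,3)] by force
next
  fix A
  assume "A \<in> ?times ` (?D1 \<times> ?D2)"
  then obtain C1 C2
    where A: "A = decomposition_closure P1 G1 C1 \<times> decomposition_closure P2 G2 C2"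
      and C1: "C1 \<subseteq> P1" "C1 \<noteq> {}" "Complete_Partial_Order.chain (\<le>) C1"
      and C2: "C2 \<subseteq> P2" "C2 \<noteq> {}" "Complete_Partial_Order.chain (\<le>) C2"
    by (auto simp: decomposition_complex_def)
  obtain C where C: "Complete_Partial_Order.chain (\<le>) C" "fst ` C = C1" "snd ` C = C2"
    using chain_with_projections finite_subset[OF C1(1) fin(1)] C1(2,3)
      finite_subset[OF C2(1) fin(2)] C2(2,3) by metis
  have sub: "C \<subseteq> P1 \<times> P2"
    using C(2,3) C1(1) C2(1) subset_fst_snd[of C] by blast
  have "C \<noteq> {}"
    using C(2) C1(2) by auto
  then have "decomposition_closure (P1 \<times> P2) (prod_decomposition_set G1 G2) C \<in> ?D"
    using sub C(1) by (intro decomposition_complexI)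
  then show "A \<in> ?D"
    unfolding closure_chain_eq_Times[OF G1 G2 sub C(1)] C(2,3) A .
qed

lemma order_iso_onI:
  assumes "\<And>x. x \<in> A \<Longrightarrow> f x \<in> B" "\<And>y. y \<in> B \<Longrightarrow> g y \<in> A"
    and "\<And>x. x \<in> A \<Longrightarrow> g (f x) = x" "\<And>y. y \<in> B \<Longrightarrow> f (g y) = y"
    and "\<And>x x'. x \<in> A \<Longrightarrow> x' \<in> A \<Longrightarrow> x \<le> x' \<Longrightarrow> f x \<le> f x'"
    and "\<And>y y'. y \<in> B \<Longrightarrow> y' \<in> B \<Longrightarrow> y \<le> y' \<Longrightarrow> g y \<le> g y'"
  shows "order_iso_on f A B"
  unfolding order_iso_on_def
proof
  show "bij_betw f A B"
    using assms(1-4) by (intro bij_betw_byWitness[where f' = g]) auto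
  show "\<forall>x\<in>A. \<forall>y\<in>A. x \<le> y \<longleftrightarrow> f x \<le> f y"
    using assms(1,3,5,6) by metis
qed

theorem corollary5p5:
  fixes P1 :: "'a::order set" and P2 :: "'b::order set"
    and G1 :: "('a \<times> 'a \<times> 'a) set" and G2 :: "('b \<times> 'b \<times> 'b) set"
  assumes "finite P1" and "finite P2"
    and "decomposition_set P1 G1" and "decomposition_set P2 G2"
  shows
    "let D = decomposition_complex (P1 \<times> P2) (prod_decomposition_set G1 G2);
         D1 = decomposition_complex P1 G1;
         D2 = decomposition_complex P2 G2
     in order_iso_on (\<lambda>A. (fst ` A, snd ` A)) D (D1 \<times> D2) \<and>
        order_iso_on (\<lambda>(A1, A2). A1 \<times> A2) (D1 \<times> D2) D \<and>
        (\<forall>A \<in> D. fst ` A \<times> snd ` A = A) \<and>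
        (\<forall>A1 \<in> D1. \<forall>A2 \<in> D2. fst ` (A1 \<times> A2) = A1 \<and> snd ` (A1 \<times> A2) = A2)"
proof -
  define D1 where "D1 = decomposition_complex P1 G1"
  define D2 where "D2 = decomposition_complex P2 G2"
  define D where "D = decomposition_complex (P1 \<times> P2) (prod_decomposition_set G1 G2)"
  let ?proj = "\<lambda>A :: ('a \<times> 'b) set. (fst ` A, snd ` A)"
  let ?times = "\<lambda>(A1 :: 'a set, A2 :: 'b set). A1 \<times> A2"
  have D: "D = ?times ` (D1 \<times> D2)"
    unfolding D_def D1_def D2_def by (rule decomposition_complex_prod[OF assms])
  \<comment> \<open>The projections recover the factors because members of the complexes are non-empty.\<close>
  have proj_times: "fst ` (A1 \<times> A2) = A1 \<and> snd ` (A1 \<times> A2) = A2" if "A1 \<in> D1" "A2 \<in> D2" for A1 A2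
    using that[unfolded D1_def D2_def, THEN decomposition_complex_nonempty] by simp
  have times_proj: "fst ` A \<times> snd ` A = A" if "A \<in> D" for A
    using that proj_times unfolding D by auto
  have proj_mem: "?proj A \<in> D1 \<times> D2" if "A \<in> D" for A
    using that proj_times unfolding D by auto
  have times_mem: "?times p \<in> D" if "p \<in> D1 \<times> D2" for p
    using that unfolding D by (rule imageI)
  have times_mono: "?times p \<le> ?times q" if "p \<le> q" for p q
    using that by (auto simp: less_eq_prod_def)
  have proj_mono: "?proj A \<le> ?proj B" if "A \<le> B" for A B
    using that by (simp add: image_mono)
  have times_proj': "?times (?proj A) = A" if "A \<in> D" for A
    using times_proj[OF that] by simp
  have proj_times': "?proj (?times p) = p" if "p \<in> D1 \<times> D2" for p
    using that proj_times by (cases p) simp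
  have "order_iso_on ?proj D (D1 \<times> D2)"
    by (rule order_iso_onI[where g = ?times])
      (erule proj_mem times_mem times_proj' proj_times' | rule proj_mono times_mono, assumption)+
  moreover have "order_iso_on ?times (D1 \<times> D2) D"
    by (rule order_iso_onI[where g = ?proj])
      (erule proj_mem times_mem times_proj' proj_times' | rule proj_mono times_mono, assumption)+
  ultimately show ?thesis
    unfolding Let_def D_def[symmetric] D1_def[symmetric] D2_def[symmetric]
    using times_proj proj_times by (intro conjI ballI) simp_all
qed

end
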